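(* Let $(X,\|\cdot\|_X)$ be a rearrangement-invariant space over $([0,\infty),\lambda)$ and let $p\in[1,\infty]$. Then $\|\cdot\|_X$ is equivalent to a $p$-homogeneous rearrangement-invariant norm if and only if there exists a constant $C>0$ such that $$\|D_rf\|_X\le C r^{-\frac1p}\|f\|_X\quad\text{for all } r>0 \text{ and all } f\in X.$$ In particular, $\|\cdot\|_X$ is a $p$-homogeneous norm if and only if $\|D_rf\|_X\le r^{-\frac1p}\|f\|_X$ for all $r>0$ and all $f\in X$.
   Context: $\lambda$ is Lebesgue measure on $[0,\infty)$ and $\mathfrak M([0,\infty))$ is the set of real-valued Lebesgue-measurable functions on $[0,\infty)$ (a.e. equal functions are identified). For $f\in\mathfrak M([0,\infty))$ and $t>0$, $f^*(t)=\inf\{s>0: \lambda(\{x:|f(x)|>s\})\le t\}$. A mapping $\|\cdot\|:\mathfrak M([0,\infty))\to[0,\infty]$ is a rearrangement-invariant (r.i.) norm if for all $f,g,f_n\in\mathfrak M([0,\infty))$ ($n\in\mathbb N$), all $a\in\mathbb R$ and all measurable $E\subset[0,\infty)$: (P1) $\|f+g\|\le\|f\|+\|g\|$, $\|af\|=|a|\|f\|$, and $\|f\|=0\Leftrightarrow f=0$ a.e.; (P2) $0\le g\le f$ a.e. implies $\|g\|\le\|f\|$; (P3) $0\le f_n\uparrow f$ a.e. implies $\|f_n\|\uparrow\|f\|$; (P4) $\lambda(E)<\infty$ implies $\|\chi_E\|<\infty$; (P5) if $\lambda(E)<\infty$ there is $C_E\in(0,\infty)$ depending only on $E$ (and the norm)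 with $\int_E f\,\mathrm d\lambda\le C_E\|f\|$ for all $f\ge0$; (P6) $f^*=g^*$ implies $\|f\|=\|g\|$. The r.i. space generated by an r.i. norm $\|\cdot\|_X$ is $X=\{f\in\mathfrak M([0,\infty)):\|f\|_X<\infty\}$. For $r>0$ the dilation operator is $D_rf(t)=f(rt)$. Convention: $t^{\frac1\infty}=t^{-\frac1\infty}=1$ for all $t>0$. For $p\in[1,\infty]$, an r.i. norm $\|\cdot\|_X$ is $p$-homogeneous if $\|D_rf\|_X=r^{-\frac1p}\|f\|_X$ for every $f\in X$ and $r>0$. Two norms are equivalent if each is bounded by a constant multiple of the other. *)

theory Defs
  imports "HOL-Analysis.Analysis"
begin

text \<open>
  Functions on the half-line are represented by functions on the reals, of which only the values
  on \<open>{0..}\<close> matter. Functions that agree almost everywhere on the half-line are not identified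
  by a quotient; lemma \<open>norm_cong_AE\<close> below shows that the norms do not distinguish them.
\<close>

abbreviation halfline :: "real measure" where
  "halfline \<equiv> lebesgue_on {0..}"

abbreviation meas_funs :: "(real \<Rightarrow> real) set" where
  "meas_funs \<equiv> borel_measurable halfline"

text \<open>
  The infimum is taken in \<^typ>\<open>ennreal\<close>, so it is infinite when no level \<open>s\<close> qualifies.
\<close>

definition rearrangement :: "(real \<Rightarrow> real) \<Rightarrow> real \<Rightarrow> ennreal" where
  "rearrangement f t =
     Inf (ennreal ` {s. 0 < s \<and> emeasure halfline {x \<in> {0..}. s < \<bar>f x\<bar>} \<le> ennreal t})"

locale ri_norm =
  fixes N :: "(real \<Rightarrow> real) \<Rightarrow> ennreal"
  assumes triangle:
      "\<And>f g. f \<in> meas_funs \<Longrightarrow> g \<in> meas_funs \<Longrightarrow> N (\<lambda>x. f x + g x) \<le> N f + N g"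
    and scale:
      "\<And>f a. f \<in> meas_funs \<Longrightarrow> N (\<lambda>x. a * f x) = ennreal \<bar>a\<bar> * N f"
    and definite:
      "\<And>f. f \<in> meas_funs \<Longrightarrow> N f = 0 \<longleftrightarrow> (AE x in halfline. f x = 0)"
    and lattice:
      "\<And>f g. f \<in> meas_funs \<Longrightarrow> g \<in> meas_funs \<Longrightarrow> (AE x in halfline. 0 \<le> g x \<and> g x \<le> f x)
        \<Longrightarrow> N g \<le> N f"
    and fatou:
      "\<And>f F. f \<in> meas_funs \<Longrightarrow> (\<And>n. F n \<in> meas_funs)
        \<Longrightarrow> (AE x in halfline. (\<forall>n. 0 \<le> F n x) \<and> incseq (\<lambda>n. F n x) \<and> (\<lambda>n. F n x) \<longlonglongrightarrow> f x)
        \<Longrightarrow> incseq (\<lambda>n. N (F n)) \<and> (\<lambda>n. N (F n)) \<longlonglongrightarrow> N f"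
    and finite_indicator:
      "\<And>E. E \<in> sets halfline \<Longrightarrow> emeasure halfline E < \<infinity> \<Longrightarrow> N (indicat_real E) < \<infinity>"
    and locally_integrable:
      "\<And>E. E \<in> sets halfline \<Longrightarrow> emeasure halfline E < \<infinity>
        \<Longrightarrow> \<exists>C::real. 0 < C \<and> (\<forall>f\<in>meas_funs. (AE x in halfline. 0 \<le> f x) \<longrightarrow>
              (\<integral>\<^sup>+x\<in>E. ennreal (f x) \<partial>halfline) \<le> ennreal C * N f)"
    and rearrangement_invariant:
      "\<And>f g. f \<in> meas_funs \<Longrightarrow> g \<in> meas_funs
        \<Longrightarrow> (\<And>t. 0 < t \<Longrightarrow> rearrangement f t = rearrangement g t) \<Longrightarrow> N f = N g"

lemma (in ri_norm) norm_cong_AE: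
  assumes f: "f \<in> meas_funs" and g: "g \<in> meas_funs" and eq: "AE x in halfline. f x = g x"
  shows "N f = N g"
proof -
  have le: "N u \<le> N v"
    if u: "u \<in> meas_funs" and v: "v \<in> meas_funs" and ae: "AE x in halfline. u x = v x" for u v
  proof -
    have d: "(\<lambda>x. u x - v x) \<in> meas_funs"
      using u v by (rule borel_measurable_diff)
    have "AE x in halfline. u x - v x = 0"
      using ae by eventually_elim simp
    then have "N (\<lambda>x. u x - v x) = 0"
      using definite[OF d] by blast
    with triangle[OF v d] show ?thesis by simp
  qed
  have "AE x in halfline. g x = f x"
    using eq by eventually_elim simp
  then show ?thesis
    using le[OF f g eq] le[OF g f] by (simp add: antisym)
qed

definition ri_space :: "((real \<Rightarrow> real) \<Rightarrow> ennreal) \<Rightarrow> (real \<Rightarrow> real) set" where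
  "ri_space N = {f \<in> meas_funs. N f < \<infinity>}"

definition dilation :: "real \<Rightarrow> (real \<Rightarrow> real) \<Rightarrow> real \<Rightarrow> real" where
  "dilation r f = (\<lambda>t. f (r * t))"

text \<open>The power \<open>r\<close> to the \<open>-1/p\<close>, which by convention is \<open>1\<close> for infinite \<open>p\<close>.\<close>

definition hom_factor :: "ennreal \<Rightarrow> real \<Rightarrow> real" where
  "hom_factor p r = (if p = \<infinity> then 1 else r powr (- (1 / enn2real p)))"

definition p_homogeneous :: "ennreal \<Rightarrow> ((real \<Rightarrow> real) \<Rightarrow> ennreal) \<Rightarrow> bool" where
  "p_homogeneous p N \<longleftrightarrow>
     (\<forall>f\<in>ri_space N. \<forall>r>0. N (dilation r f) = ennreal (hom_factor p r) * N f)"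

definition equivalent_norms ::
    "((real \<Rightarrow> real) \<Rightarrow> ennreal) \<Rightarrow> ((real \<Rightarrow> real) \<Rightarrow> ennreal) \<Rightarrow> bool" where
  "equivalent_norms N N' \<longleftrightarrow>
     (\<exists>C::real. 0 < C \<and> (\<forall>f\<in>meas_funs. N f \<le> ennreal C * N' f)) \<and>
     (\<exists>C::real. 0 < C \<and> (\<forall>f\<in>meas_funs. N' f \<le> ennreal C * N f))"

end

theory Submission
  imports Defs
begin

text \<open>
  A norm satisfying the dilation bound with constant \<open>C\<close> is made homogeneous by averaging over
  the dilation group, with a supremum in the place of an average:
  \<open>N' f = (SUP r>0. r powr (1/p) * N (D\<^sub>r f))\<close>. Taking \<open>r = 1\<close> gives \<open>N \<le> N'\<close>, and the dilation
  bound says precisely that \<open>N' \<le> C * N\<close>, so the two are equivalent. Since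
  \<open>D\<^sub>r (D\<^sub>s f) = D\<^bsub>rs\<^esub> f\<close>, dilating \<open>f\<close> by \<open>s\<close> only reindexes the supremum and pulls out the factor
  \<open>s powr (-1/p)\<close>; this is homogeneity (\<open>homogenization_dilation\<close>).

  The norm axioms for \<open>N'\<close> (\<open>ri_norm_homogenization\<close>) fall into two groups. Subadditivity,
  homogeneity in scalars, monotonicity, the Fatou property and rearrangement invariance hold for
  \<open>f \<mapsto> N (D\<^sub>r f)\<close> with each \<open>r\<close>, because dilation multiplies Lebesgue measure by a constant and so
  respects null sets and equimeasurability. They then pass to the supremum; for the Fatou property
  this is the interchange of two suprema. Definiteness, finiteness on indicators and local
  integrability follow from \<open>N \<le> N' \<le> C * N\<close>.

  For \<open>C = 1\<close> no new norm is needed: the bound for \<open>1/r\<close> applied to \<open>D\<^sub>r f\<close> is the reverse of the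
  bound for \<open>r\<close> applied to \<open>f\<close>.
\<close>

section \<open>Dilations of the half-line\<close>

text \<open>A dilation is a bijection of the half-line that preserves measurability in both directions, so
  the formula extends to nonmeasurable \<open>A\<close>, where both sides are \<open>0\<close>.\<close>

lemma emeasure_halfline_vimage_scale:
  assumes "0 < r" and "A \<subseteq> {0..}"
  shows "emeasure halfline {x \<in> {0..}. r * x \<in> A} = ennreal (1 / r) * emeasure halfline A"
proof -
  have img: "{x \<in> {0..}. r * x \<in> A} = (\<lambda>x. (1 / r) *\<^sub>R x + 0) ` A" (is "?L = ?R")
  proof
    show "?L \<subseteq> ?R"
    proof
      fix x assume "x \<in> ?L"
      then have "r * x \<in> A" and "x = (1 / r) *\<^sub>R (r * x) + 0" using assms(1) by auto
      then show "x \<in> ?R" by blast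
    qed
    show "?R \<subseteq> ?L" using assms by auto
  qed
  have "emeasure halfline ?L = emeasure lebesgue ?L"
    by (rule emeasure_restrict_space) auto
  also have "\<dots> = ennreal (1 / r) * emeasure lebesgue A"
    unfolding img using emeasure_lebesgue_affine[of "1 / r" 0 A] assms(1) by simp
  also have "emeasure lebesgue A = emeasure halfline A"
    using assms(2) by (intro emeasure_restrict_space[symmetric]) auto
  finally show ?thesis .
qed

lemma scale_measurable_halfline:
  assumes "0 < r"
  shows "(\<lambda>x. r * x) \<in> halfline \<rightarrow>\<^sub>M halfline"
proof -
  have "(\<lambda>x. r *\<^sub>R x) \<in> (lebesgue :: real measure) \<rightarrow>\<^sub>M lebesgue"
    by (rule lebesgue_measurable_scaling)
  then show ?thesis
    using assms by (auto intro!: measurable_restrict_space3)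
qed

lemma dilation_measurable:
  assumes "0 < r" and "f \<in> meas_funs"
  shows "dilation r f \<in> meas_funs"
  unfolding dilation_def using measurable_compose[OF scale_measurable_halfline assms(2)] assms(1) by blast

lemma AE_halfline_scale:
  assumes "0 < r" and "AE x in halfline. P x"
  shows "AE x in halfline. P (r * x)"
proof -
  obtain Z where Z: "{x \<in> space halfline. \<not> P x} \<subseteq> Z" "Z \<in> null_sets halfline"
    using assms(2) by (auto elim!: AE_E simp: null_sets_def)
  have sub: "Z \<subseteq> {0..}"
    using sets.sets_into_space[of Z halfline] Z(2) by (auto simp: null_sets_def)
  have eq: "{x \<in> {0..}. r * x \<in> Z} = (\<lambda>x. r * x) -` Z \<inter> space halfline"
    by auto
  have "{x \<in> {0..}. r * x \<in> Z} \<in> null_sets halfline"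
  proof (rule null_setsI)
    show "emeasure halfline {x \<in> {0..}. r * x \<in> Z} = 0"
      using emeasure_halfline_vimage_scale[OF assms(1) sub] Z(2) by (simp add: null_sets_def)
    show "{x \<in> {0..}. r * x \<in> Z} \<in> sets halfline"
      unfolding eq using measurable_sets[OF scale_measurable_halfline[OF assms(1)]] Z(2)
      by (simp add: null_sets_def)
  qed
  then show ?thesis
    by (rule AE_I') (use Z(1) assms(1) in auto)
qed

lemma rearrangement_dilation:
  assumes r: "0 < r" and t: "0 < t"
  shows "rearrangement (dilation r f) t = rearrangement f (r * t)"
proof -
  have "emeasure halfline {x \<in> {0..}. s < \<bar>dilation r f x\<bar>} \<le> ennreal t \<longleftrightarrow>
        emeasure halfline {x \<in> {0..}. s < \<bar>f x\<bar>} \<le> ennreal (r * t)" for s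
  proof -
    let ?m = "emeasure halfline {x \<in> {0..}. s < \<bar>f x\<bar>}"
    have "{x \<in> {0..}. s < \<bar>dilation r f x\<bar>} = {x \<in> {0..}. r * x \<in> {x \<in> {0..}. s < \<bar>f x\<bar>}}"
      using r by (auto simp: dilation_def)
    then have "emeasure halfline {x \<in> {0..}. s < \<bar>dilation r f x\<bar>} = ennreal (1 / r) * ?m"
      using emeasure_halfline_vimage_scale[OF r, of "{x \<in> {0..}. s < \<bar>f x\<bar>}"] by auto
    moreover have "ennreal (1 / r) * ?m \<le> ennreal t \<longleftrightarrow> ?m \<le> ennreal (r * t)"
    proof
      assume "ennreal (1 / r) * ?m \<le> ennreal t"
      then have "ennreal r * (ennreal (1 / r) * ?m) \<le> ennreal r * ennreal t"
        by (rule mult_left_mono) simp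
      then show "?m \<le> ennreal (r * t)"
        using r t by (simp add: mult.assoc[symmetric] ennreal_mult[symmetric])
    next
      assume "?m \<le> ennreal (r * t)"
      then have "ennreal (1 / r) * ?m \<le> ennreal (1 / r) * ennreal (r * t)"
        by (rule mult_left_mono) simp
      then show "ennreal (1 / r) * ?m \<le> ennreal t"
        using r t by (simp add: ennreal_mult[symmetric])
    qed
    ultimately show ?thesis by simp
  qed
  then show ?thesis
    by (simp add: rearrangement_def)
qed

lemma dilation_dilation: "dilation r (dilation s f) = dilation (r * s) f"
  by (simp add: dilation_def mult_ac)

lemma dilation_1 [simp]: "dilation 1 f = f"
  by (simp add: dilation_def)

section \<open>The homogeneity factor\<close>

lemma hom_factor_pos: "0 < r \<Longrightarrow> 0 < hom_factor p r"
  by (simp add: hom_factor_def)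

lemma hom_factor_1 [simp]: "hom_factor p 1 = 1"
  by (simp add: hom_factor_def)

lemma hom_factor_mult:
  "0 < r \<Longrightarrow> 0 < s \<Longrightarrow> hom_factor p (r * s) = hom_factor p r * hom_factor p s"
  by (simp add: hom_factor_def powr_mult)

lemma hom_factor_cancel:
  assumes "0 < r"
  shows "ennreal (hom_factor p r) * (ennreal (hom_factor p (1 / r)) * a) = a"
proof -
  have "hom_factor p r * hom_factor p (1 / r) = 1"
    using hom_factor_mult[of r "1 / r" p] assms by simp
  then show ?thesis
    using hom_factor_pos[of r p] hom_factor_pos[of "1 / r" p] assms
    by (simp add: mult.assoc[symmetric] ennreal_mult[symmetric])
qed

section \<open>Homogenization of a norm\<close>

text \<open>The weight \<open>hom_factor p (1 / r)\<close> is the reciprocal of the factor by which a homogeneous norm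
  changes under dilation by \<open>r\<close>, so for such a norm every term of the
  supremum is the norm itself.\<close>

definition homogenization ::
    "ennreal \<Rightarrow> ((real \<Rightarrow> real) \<Rightarrow> ennreal) \<Rightarrow> (real \<Rightarrow> real) \<Rightarrow> ennreal" where
  "homogenization p N f = (SUP r\<in>{0<..}. ennreal (hom_factor p (1 / r)) * N (dilation r f))"

lemma le_homogenization: "N f \<le> homogenization p N f"
  unfolding homogenization_def by (rule SUP_upper2[of 1]) auto

lemma dilation_le_homogenization:
  "0 < r \<Longrightarrow> ennreal (hom_factor p (1 / r)) * N (dilation r f) \<le> homogenization p N f"
  unfolding homogenization_def by (rule SUP_upper) simp

text \<open>The supremum runs over the whole dilation group, so a dilation of the argument is absorbed by
  a translation of the index.\<close>

lemma homogenization_dilation: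
  assumes s: "0 < s"
  shows "homogenization p N (dilation s f) = ennreal (hom_factor p s) * homogenization p N f"
proof (rule antisym)
  show "homogenization p N (dilation s f) \<le> ennreal (hom_factor p s) * homogenization p N f"
    unfolding homogenization_def[of p N "dilation s f"]
  proof (rule SUP_least)
    fix r :: real assume "r \<in> {0<..}"
    then have r: "0 < r" by simp
    have "hom_factor p (1 / r) = hom_factor p s * hom_factor p (1 / (r * s))"
      using hom_factor_mult[of s "1 / (r * s)" p] r s by simp
    then have "ennreal (hom_factor p (1 / r)) * N (dilation r (dilation s f)) =
        ennreal (hom_factor p s) * (ennreal (hom_factor p (1 / (r * s))) * N (dilation (r * s) f))"
      using hom_factor_pos[of s p] hom_factor_pos[of "1 / (r * s)" p] r s
      by (simp add: dilation_dilation ennreal_mult mult.assoc)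
    also have "\<dots> \<le> ennreal (hom_factor p s) * homogenization p N f"
      using r s by (intro mult_left_mono dilation_le_homogenization) auto
    finally show "ennreal (hom_factor p (1 / r)) * N (dilation r (dilation s f))
        \<le> ennreal (hom_factor p s) * homogenization p N f" .
  qed
  have "homogenization p N f \<le> ennreal (hom_factor p (1 / s)) * homogenization p N (dilation s f)"
    unfolding homogenization_def[of p N f]
  proof (rule SUP_least)
    fix r :: real assume "r \<in> {0<..}"
    then have r: "0 < r" by simp
    have "hom_factor p (1 / r) = hom_factor p (1 / s) * hom_factor p (1 / (r / s))"
      using hom_factor_mult[of "1 / s" "1 / (r / s)" p] r s by simp
    then have "ennreal (hom_factor p (1 / r)) * N (dilation r f) =
        ennreal (hom_factor p (1 / s)) *
          (ennreal (hom_factor p (1 / (r / s))) * N (dilation (r / s) (dilation s f)))"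
      using hom_factor_pos[of "1 / s" p] hom_factor_pos[of "1 / (r / s)" p] r s
      by (simp add: dilation_dilation ennreal_mult mult.assoc)
    also have "\<dots> \<le> ennreal (hom_factor p (1 / s)) * homogenization p N (dilation s f)"
      using r s by (intro mult_left_mono dilation_le_homogenization) auto
    finally show "ennreal (hom_factor p (1 / r)) * N (dilation r f)
        \<le> ennreal (hom_factor p (1 / s)) * homogenization p N (dilation s f)" .
  qed
  then have "ennreal (hom_factor p s) * homogenization p N f
      \<le> ennreal (hom_factor p s) *
          (ennreal (hom_factor p (1 / s)) * homogenization p N (dilation s f))"
    by (rule mult_left_mono) simp
  then show "ennreal (hom_factor p s) * homogenization p N f \<le> homogenization p N (dilation s f)"
    by (simp add: hom_factor_cancel[OF s])
qed

text \<open>The weight cancels the growth that the dilation bound allows, and \<open>C\<close> remains. Outside the space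
  generated by \<open>N\<close>, where there is no dilation bound, the right-hand side is infinite.\<close>

lemma homogenization_le:
  assumes C: "0 < C"
    and bound: "\<forall>r>0. \<forall>f\<in>ri_space N. N (dilation r f) \<le> ennreal (C * hom_factor p r) * N f"
    and f: "f \<in> meas_funs"
  shows "homogenization p N f \<le> ennreal C * N f"
proof (cases "N f < \<infinity>")
  case True
  then have fX: "f \<in> ri_space N"
    using f by (simp add: ri_space_def)
  show ?thesis
    unfolding homogenization_def
  proof (rule SUP_least)
    fix r :: real assume "r \<in> {0<..}"
    then have r: "0 < r" by simp
    have "ennreal (hom_factor p (1 / r)) * N (dilation r f)
        \<le> ennreal (hom_factor p (1 / r)) * (ennreal (C * hom_factor p r) * N f)"
      using bound r fX by (intro mult_left_mono) auto
    also have "\<dots> = ennreal (hom_factor p r) * (ennreal (hom_factor p (1 / r)) * (ennreal C * N f))"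
      using C hom_factor_pos[OF r, of p] by (simp add: ennreal_mult mult_ac)
    also have "\<dots> = ennreal C * N f"
      by (rule hom_factor_cancel[OF r])
    finally show "ennreal (hom_factor p (1 / r)) * N (dilation r f) \<le> ennreal C * N f" .
  qed
next
  case False
  then have "N f = top"
    by (simp add: not_less top_unique)
  then show ?thesis
    using C by (simp add: ennreal_mult_top)
qed

lemma ri_norm_homogenization:
  assumes N: "ri_norm N" and C: "0 < C"
    and bound: "\<forall>r>0. \<forall>f\<in>ri_space N. N (dilation r f) \<le> ennreal (C * hom_factor p r) * N f"
  shows "ri_norm (homogenization p N)"
proof -
  interpret ri_norm N by (rule N)
  let ?M = "homogenization p N"
  note le_C = homogenization_le[OF C bound]
  show ?thesis
  proof
    fix f g assume f: "f \<in> meas_funs" and g: "g \<in> meas_funs"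
    show "?M (\<lambda>x. f x + g x) \<le> ?M f + ?M g"
      unfolding homogenization_def[of p N "\<lambda>x. f x + g x"]
    proof (rule SUP_least)
      fix r :: real assume "r \<in> {0<..}"
      then have r: "0 < r" by simp
      have "N (dilation r (\<lambda>x. f x + g x)) \<le> N (dilation r f) + N (dilation r g)"
        using triangle[OF dilation_measurable[OF r f] dilation_measurable[OF r g]]
        by (simp add: dilation_def)
      then have "ennreal (hom_factor p (1 / r)) * N (dilation r (\<lambda>x. f x + g x)) \<le>
          ennreal (hom_factor p (1 / r)) * (N (dilation r f) + N (dilation r g))"
        by (rule mult_left_mono) simp
      also have "\<dots> \<le> ?M f + ?M g"
        unfolding distrib_left using r by (intro add_mono dilation_le_homogenization)
      finally show "ennreal (hom_factor p (1 / r)) * N (dilation r (\<lambda>x. f x + g x)) \<le> ?M f + ?M g" .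
    qed
  next
    fix f a assume f: "f \<in> meas_funs"
    have "N (dilation r (\<lambda>x. a * f x)) = ennreal \<bar>a\<bar> * N (dilation r f)" if "0 < r" for r
      using scale[OF dilation_measurable[OF that f], of a] by (simp add: dilation_def)
    then have "?M (\<lambda>x. a * f x) =
        (SUP r\<in>{0<..}. ennreal \<bar>a\<bar> * (ennreal (hom_factor p (1 / r)) * N (dilation r f)))"
      unfolding homogenization_def by (intro SUP_cong) (auto simp: mult.left_commute)
    then show "?M (\<lambda>x. a * f x) = ennreal \<bar>a\<bar> * ?M f"
      by (simp add: homogenization_def SUP_mult_left_ennreal)
  next
    fix f assume f: "f \<in> meas_funs"
    have "?M f = 0 \<longleftrightarrow> N f = 0"
      using le_homogenization[of N f p] le_C[OF f] by auto
    then show "?M f = 0 \<longleftrightarrow> (AE x in halfline. f x = 0)"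
      using definite[OF f] by simp
  next
    fix f g assume f: "f \<in> meas_funs" and g: "g \<in> meas_funs"
      and ae: "AE x in halfline. 0 \<le> g x \<and> g x \<le> f x"
    have "N (dilation r g) \<le> N (dilation r f)" if r: "0 < r" for r
      using lattice[OF dilation_measurable[OF r f] dilation_measurable[OF r g]]
        AE_halfline_scale[OF r ae] by (simp add: dilation_def)
    then show "?M g \<le> ?M f"
      unfolding homogenization_def by (intro SUP_mono) (force intro!: mult_left_mono)
  next
    fix f and F :: "nat \<Rightarrow> real \<Rightarrow> real"
    assume f: "f \<in> meas_funs" and F: "\<And>n. F n \<in> meas_funs"
      and ae: "AE x in halfline. (\<forall>n. 0 \<le> F n x) \<and> incseq (\<lambda>n. F n x) \<and> (\<lambda>n. F n x) \<longlonglongrightarrow> f x"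
    have fat: "incseq (\<lambda>n. N (dilation r (F n))) \<and>
        (\<lambda>n. N (dilation r (F n))) \<longlonglongrightarrow> N (dilation r f)" if r: "0 < r" for r
      using fatou[OF dilation_measurable[OF r f] dilation_measurable[OF r F]]
        AE_halfline_scale[OF r ae] by (simp add: dilation_def)
    then have sup: "(SUP n. N (dilation r (F n))) = N (dilation r f)" if "0 < r" for r
      using that LIMSEQ_SUP LIMSEQ_unique by blast
    have inc: "incseq (\<lambda>n. ?M (F n))"
    proof (rule incseq_SucI)
      fix n
      show "?M (F n) \<le> ?M (F (Suc n))"
        unfolding homogenization_def
        using fat by (intro SUP_mono) (force intro!: mult_left_mono dest: incseq_SucD)
    qed
    have "?M f = (SUP r\<in>{0<..}. SUP n. ennreal (hom_factor p (1 / r)) * N (dilation r (F n)))"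
      unfolding homogenization_def
      by (intro SUP_cong) (simp_all add: SUP_mult_left_ennreal[symmetric] sup)
    also have "\<dots> = (SUP n. ?M (F n))"
      unfolding homogenization_def by (rule SUP_commute)
    finally have "(\<lambda>n. ?M (F n)) \<longlonglongrightarrow> ?M f"
      using LIMSEQ_SUP[OF inc] by simp
    with inc show "incseq (\<lambda>n. ?M (F n)) \<and> (\<lambda>n. ?M (F n)) \<longlonglongrightarrow> ?M f" ..
  next
    fix E assume E: "E \<in> sets halfline" "emeasure halfline E < \<infinity>"
    then have "indicat_real E \<in> meas_funs"
      by simp
    from le_C[OF this] finite_indicator[OF E] show "?M (indicat_real E) < \<infinity>"
      by (auto simp: ennreal_mult_less_top intro: le_less_trans)
  next
    fix E assume E: "E \<in> sets halfline" "emeasure halfline E < \<infinity>"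
    obtain K where K: "0 < K" "\<And>f. f \<in> meas_funs \<Longrightarrow> (AE x in halfline. 0 \<le> f x) \<Longrightarrow>
        (\<integral>\<^sup>+x\<in>E. ennreal (f x) \<partial>halfline) \<le> ennreal K * N f"
      using locally_integrable[OF E] by blast
    have "(\<integral>\<^sup>+x\<in>E. ennreal (f x) \<partial>halfline) \<le> ennreal K * ?M f"
      if "f \<in> meas_funs" "AE x in halfline. 0 \<le> f x" for f
      using K(2)[OF that] mult_left_mono[OF le_homogenization, of "ennreal K" N f p]
      by (rule order_trans) simp
    with K(1) show "\<exists>C::real. 0 < C \<and> (\<forall>f\<in>meas_funs. (AE x in halfline. 0 \<le> f x) \<longrightarrow>
        (\<integral>\<^sup>+x\<in>E. ennreal (f x) \<partial>halfline) \<le> ennreal C * ?M f)"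
      by blast
  next
    fix f g assume f: "f \<in> meas_funs" and g: "g \<in> meas_funs"
      and eq: "\<And>t. 0 < t \<Longrightarrow> rearrangement f t = rearrangement g t"
    have "N (dilation r f) = N (dilation r g)" if r: "0 < r" for r
      using r eq by (intro rearrangement_invariant dilation_measurable f g)
        (simp_all add: rearrangement_dilation)
    then show "?M f = ?M g"
      unfolding homogenization_def by (intro SUP_cong) simp_all
  qed
qed

section \<open>Characterization of homogeneity up to equivalence\<close>

text \<open>The estimate runs through \<open>N'\<close> and back, and each passage costs one equivalence constant.\<close>

lemma dilation_bound_of_equivalent_homogeneous:
  assumes hom: "p_homogeneous p N'" and equiv: "equivalent_norms N N'"
  shows "\<exists>C::real. 0 < C \<and>
    (\<forall>r>0. \<forall>f\<in>ri_space N. N (dilation r f) \<le> ennreal (C * hom_factor p r) * N f)"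
proof -
  obtain A B :: real where A: "0 < A" "\<And>f. f \<in> meas_funs \<Longrightarrow> N f \<le> ennreal A * N' f"
    and B: "0 < B" "\<And>f. f \<in> meas_funs \<Longrightarrow> N' f \<le> ennreal B * N f"
    using equiv unfolding equivalent_norms_def by blast
  have "N (dilation r f) \<le> ennreal (A * B * hom_factor p r) * N f"
    if r: "0 < r" and fX: "f \<in> ri_space N" for r f
  proof -
    have f: "f \<in> meas_funs" "N f < \<infinity>"
      using fX by (auto simp: ri_space_def)
    \<comment> \<open>homogeneity of \<open>N'\<close> applies only where \<open>N'\<close> is finite\<close>
    have "ennreal B * N f < \<infinity>"
      using f(2) by (simp add: ennreal_mult_less_top)
    with B(2)[OF f(1)] have "f \<in> ri_space N'"
      using f(1) by (auto simp: ri_space_def intro: le_less_trans)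
    then have eq: "N' (dilation r f) = ennreal (hom_factor p r) * N' f"
      using hom r by (simp add: p_homogeneous_def)
    have "N (dilation r f) \<le> ennreal A * (ennreal (hom_factor p r) * N' f)"
      using A(2)[OF dilation_measurable[OF r f(1)]] by (simp add: eq)
    also have "\<dots> \<le> ennreal A * (ennreal (hom_factor p r) * (ennreal B * N f))"
      by (intro mult_left_mono B(2) f(1)) auto
    also have "\<dots> = ennreal (A * B * hom_factor p r) * N f"
      using A(1) B(1) hom_factor_pos[OF r, of p] by (simp add: ennreal_mult mult_ac)
    finally show ?thesis .
  qed
  then show ?thesis
    using A(1) B(1) by (intro exI[of _ "A * B"]) simp
qed

text \<open>Dilations are invertible with inverse factor \<open>1 / r\<close>, and \<open>hom_factor\<close> is multiplicative; hence
  upper bounds with constant \<open>1\<close> for all \<open>r\<close> are also lower bounds.\<close>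

lemma p_homogeneous_iff_dilation_le:
  "p_homogeneous p N \<longleftrightarrow>
    (\<forall>r>0. \<forall>f\<in>ri_space N. N (dilation r f) \<le> ennreal (hom_factor p r) * N f)"
proof
  assume "p_homogeneous p N"
  then show "\<forall>r>0. \<forall>f\<in>ri_space N. N (dilation r f) \<le> ennreal (hom_factor p r) * N f"
    by (simp add: p_homogeneous_def)
next
  assume bound: "\<forall>r>0. \<forall>f\<in>ri_space N. N (dilation r f) \<le> ennreal (hom_factor p r) * N f"
  show "p_homogeneous p N"
    unfolding p_homogeneous_def
  proof (intro ballI allI impI antisym)
    fix f and r :: real assume fX: "f \<in> ri_space N" and r: "0 < r"
    show le: "N (dilation r f) \<le> ennreal (hom_factor p r) * N f"
      using bound fX r by blast
    have "ennreal (hom_factor p r) * N f < \<infinity>"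
      using fX by (simp add: ri_space_def ennreal_mult_less_top)
    then have "dilation r f \<in> ri_space N"
      using fX le dilation_measurable[OF r, of f] by (auto simp: ri_space_def intro: le_less_trans)
    then have "N (dilation (1 / r) (dilation r f))
        \<le> ennreal (hom_factor p (1 / r)) * N (dilation r f)"
      using bound r by simp
    then have "N f \<le> ennreal (hom_factor p (1 / r)) * N (dilation r f)"
      using r by (simp add: dilation_dilation)
    then have "ennreal (hom_factor p r) * N f
        \<le> ennreal (hom_factor p r) * (ennreal (hom_factor p (1 / r)) * N (dilation r f))"
      by (rule mult_left_mono) simp
    then show "ennreal (hom_factor p r) * N f \<le> N (dilation r f)"
      by (simp only: hom_factor_cancel[OF r])
  qed
qed

theorem proposition2p7:
  fixes N :: "(real \<Rightarrow> real) \<Rightarrow> ennreal" and p :: ennreal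
  assumes "ri_norm N" and "1 \<le> p"
  shows "((\<exists>N'. ri_norm N' \<and> p_homogeneous p N' \<and> equivalent_norms N N') \<longleftrightarrow>
            (\<exists>C::real. 0 < C \<and>
              (\<forall>r>0. \<forall>f\<in>ri_space N.
                 N (dilation r f) \<le> ennreal (C * hom_factor p r) * N f))) \<and>
         (p_homogeneous p N \<longleftrightarrow>
            (\<forall>r>0. \<forall>f\<in>ri_space N.
               N (dilation r f) \<le> ennreal (hom_factor p r) * N f))"
proof (intro conjI iffI)
  assume "\<exists>N'. ri_norm N' \<and> p_homogeneous p N' \<and> equivalent_norms N N'"
  then show "\<exists>C::real. 0 < C \<and>
      (\<forall>r>0. \<forall>f\<in>ri_space N. N (dilation r f) \<le> ennreal (C * hom_factor p r) * N f)"
    using dilation_bound_of_equivalent_homogeneous by blast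
next
  assume "\<exists>C::real. 0 < C \<and>
      (\<forall>r>0. \<forall>f\<in>ri_space N. N (dilation r f) \<le> ennreal (C * hom_factor p r) * N f)"
  then obtain C :: real where C: "0 < C" and bound: "\<forall>r>0. \<forall>f\<in>ri_space N.
      N (dilation r f) \<le> ennreal (C * hom_factor p r) * N f"
    by blast
  let ?M = "homogenization p N"
  have "ri_norm ?M"
    using assms(1) C bound by (rule ri_norm_homogenization)
  moreover have "p_homogeneous p ?M"
    by (simp add: p_homogeneous_def homogenization_dilation)
  moreover have "equivalent_norms N ?M"
    unfolding equivalent_norms_def
  proof
    show "\<exists>C::real. 0 < C \<and> (\<forall>f\<in>meas_funs. N f \<le> ennreal C * ?M f)"
      using le_homogenization by (intro exI[of _ 1]) simp
    show "\<exists>C::real. 0 < C \<and> (\<forall>f\<in>meas_funs. ?M f \<le> ennreal C * N f)"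
      using C homogenization_le[OF C bound] by blast
  qed
  ultimately show "\<exists>N'. ri_norm N' \<and> p_homogeneous p N' \<and> equivalent_norms N N'"
    by blast
qed (use p_homogeneous_iff_dilation_le in blast)+

end
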